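(* Suppose that $(PF)(x)\ge F(x)$ for all $x\in\mathbf X$, and that there exist constants $L\in\mathbb R$, $C<\infty$ and $\rho\in(0,1)$ such that $\sup_{x\in\mathbf X}|(P^tF)(x)-L|\le C\rho^t$ for all $t\in\mathbb N_0$. Let $\gamma\in(0,1)$ be given. If $k^\star_\gamma(x)=\infty$ for some $x\in\mathbf X$, then the always-$n$ policy $\varphi^n$, defined by $\varphi^n(y,k)=n$ for all $(y,k)\in\mathbf S$, is $\gamma$-discounted optimal, i.e., $V^{\varphi^n}_\gamma(y,k)=V_\gamma(y,k)$ for all $y\in\mathbf X$ and $k\ge0$.
   Context: Setting. $\mathbf X$ is a Borel space, $P$ is a stochastic (Markov) kernel on $\mathbf X$ given $\mathbf X$, $\nu$ is a probability measure on $\mathbf X$, $F:\mathbf X\to[0,\infty]$ is measurable, and $G(n),G(r)\in[0,\infty)$ are constants. $\mathbb N_0=\{0,1,2,\dots\}$. $P^k$ is the $k$-fold composition of $P$ ($P^0$ is the identity kernel) and $(P^kF)(x)=\int_{\mathbf X}F(y)P^k(dy\mid x)$. The MDP $\{\mathbf S,\mathbf A,Q,c\}$ (the fully observed reduction of the Restart POMDP) has state space $\mathbf S=\mathbf X\times\mathbb N_0$ (last observed state, time elapsed since last restart), action space $\mathbf A=\{n,r\}$ ($n$: no intervention, $r$: restart), transition kernel $Q(dx'\times dk'\mid(x,k),n)=\delta_x(dx')\delta_{k+1}(dk')$, $Q(dx'\times dk'\mid(x,k),r)=\nu(dx')\delta_0(dk')$, and one-step cost $c(x,k;a)=(P^kF)(x)+G(a)$.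 A policy $\pi=\{\pi_t\}_{t\ge0}$ is a sequence of stochastic kernels $\pi_t$ on $\mathbf A$ given $(\mathbf S\times\mathbf A)^t\times\mathbf S$ (randomized, history-dependent); a deterministic stationary policy is identified with a measurable map $\varphi:\mathbf S\to\mathbf A$ (action $\varphi(s_t)$ is used at each time $t$). $\mathsf E^\pi_{x,k}$ is the expectation for the process $\{(S_t,A_t)\}$ of states and actions under $\pi$ started at $(x,k)$. For $\gamma\in(0,1)$, $V^\pi_\gamma(x,k)=\mathsf E^\pi_{x,k}\big[\sum_{t\ge0}\gamma^t c(S_t,A_t)\big]$ and $V_\gamma(x,k)=\inf_\pi V^\pi_\gamma(x,k)$. Threshold index: with $V_{0,\gamma}=\int_{\mathbf X}V_\gamma(z,0)\,\nu(dz)$ and $A(\gamma)=G(r)+\gamma V_{0,\gamma}$, $$k^\star_\gamma(x)=\inf\{k\in\mathbb N_0: A(\gamma)\le G(n)+\gamma V_\gamma(x,k+1)\}\in\mathbb N_0\cup\{\infty\},\qquad \inf\emptyset=\infty.$$ *)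

theory Defs
  imports "HOL-Probability.Probability"
begin

section \<open>Discounted Markov decision processes\<close>

text \<open>
  A stochastic kernel on \<open>N\<close> given \<open>M\<close> is a measurable map \<open>M \<rightarrow>\<^sub>M prob_algebra N\<close>.
  A history \<open>(s\<^sub>0, a\<^sub>0, \<dots>, s\<^bsub>t-1\<^esub>, a\<^bsub>t-1\<^esub>, s\<^sub>t)\<close> is represented by the pair of the extensional
  function \<open>i \<mapsto> (s\<^sub>i, a\<^sub>i)\<close> on \<open>{0..<t}\<close> and the current state \<open>s\<^sub>t\<close>.
\<close>

definition history_space :: "'s measure \<Rightarrow> 'a measure \<Rightarrow> nat \<Rightarrow> ((nat \<Rightarrow> 's \<times> 'a) \<times> 's) measure" where
  "history_space S A t = PiM {0..<t} (\<lambda>_. S \<Otimes>\<^sub>M A) \<Otimes>\<^sub>M S"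

type_synonym ('s, 'a) policy = "nat \<Rightarrow> (nat \<Rightarrow> 's \<times> 'a) \<times> 's \<Rightarrow> 'a measure"

definition policies :: "'s measure \<Rightarrow> 'a measure \<Rightarrow> ('s, 'a) policy set" where
  "policies S A = {\<pi>. \<forall>t. \<pi> t \<in> history_space S A t \<rightarrow>\<^sub>M prob_algebra A}"

definition stationary_policy :: "'a measure \<Rightarrow> ('s \<Rightarrow> 'a) \<Rightarrow> ('s, 'a) policy" where
  "stationary_policy A \<phi> t h = return A (\<phi> (snd h))"

text \<open>
  The conditional distribution of \<open>(S\<^sub>t, A\<^sub>t)\<close> given \<open>(S\<^sub>i, A\<^sub>i)\<close> for \<open>i < t\<close>, with \<open>S\<^sub>0 = s\<close>.
\<close>

definition mdp_step ::
  "'s measure \<Rightarrow> 'a measure \<Rightarrow> ('s \<times> 'a \<Rightarrow> 's measure) \<Rightarrow> ('s, 'a) policy \<Rightarrow> 's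
    \<Rightarrow> nat \<Rightarrow> (nat \<Rightarrow> 's \<times> 'a) \<Rightarrow> ('s \<times> 'a) measure" where
  "mdp_step S A Q \<pi> s t \<omega> =
     (if t = 0 then return S s else Q (\<omega> (t - 1))) \<bind>
       (\<lambda>s'. \<pi> t (\<omega>, s') \<bind> (\<lambda>a. return (S \<Otimes>\<^sub>M A) (s', a)))"

text \<open>
  The law of the process \<open>{(S\<^sub>t, A\<^sub>t)}\<close>: the Ionescu-Tulcea measure of these conditional
  distributions. The locale assumptions are discharged by \<open>Ionescu_Tulcea_mdp_step\<close> below.
\<close>

definition mdp_measure ::
  "'s measure \<Rightarrow> 'a measure \<Rightarrow> ('s \<times> 'a \<Rightarrow> 's measure) \<Rightarrow> ('s, 'a) policy \<Rightarrow> 's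
    \<Rightarrow> (nat \<Rightarrow> 's \<times> 'a) measure" where
  "mdp_measure S A Q \<pi> s =
     projective_family.lim UNIV
       (Ionescu_Tulcea.CI (mdp_step S A Q \<pi> s) (\<lambda>_. S \<Otimes>\<^sub>M A)) (\<lambda>_. S \<Otimes>\<^sub>M A)"

definition policy_value ::
  "'s measure \<Rightarrow> 'a measure \<Rightarrow> ('s \<times> 'a \<Rightarrow> 's measure) \<Rightarrow> ('s \<times> 'a \<Rightarrow> ennreal) \<Rightarrow> real
    \<Rightarrow> ('s, 'a) policy \<Rightarrow> 's \<Rightarrow> ennreal" where
  "policy_value S A Q c \<gamma> \<pi> s =
     (\<integral>\<^sup>+\<omega>. (\<Sum>t. ennreal (\<gamma> ^ t) * c (\<omega> t)) \<partial>mdp_measure S A Q \<pi> s)"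

definition optimal_value ::
  "'s measure \<Rightarrow> 'a measure \<Rightarrow> ('s \<times> 'a \<Rightarrow> 's measure) \<Rightarrow> ('s \<times> 'a \<Rightarrow> ennreal) \<Rightarrow> real
    \<Rightarrow> 's \<Rightarrow> ennreal" where
  "optimal_value S A Q c \<gamma> s = (INF \<pi>\<in>policies S A. policy_value S A Q c \<gamma> \<pi> s)"

lemma Ionescu_Tulcea_mdp_step:
  assumes Q[measurable]: "Q \<in> S \<Otimes>\<^sub>M A \<rightarrow>\<^sub>M prob_algebra S"
    and \<pi>: "\<pi> \<in> policies S A" and s: "s \<in> space S"
  shows "Ionescu_Tulcea (mdp_step S A Q \<pi> s) (\<lambda>_. S \<Otimes>\<^sub>M A)"
proof -
  have step: "mdp_step S A Q \<pi> s t \<in> PiM {0..<t} (\<lambda>_. S \<Otimes>\<^sub>M A) \<rightarrow>\<^sub>M prob_algebra (S \<Otimes>\<^sub>M A)" for t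
  proof -
    have \<pi>t[measurable]: "\<pi> t \<in> PiM {0..<t} (\<lambda>_. S \<Otimes>\<^sub>M A) \<Otimes>\<^sub>M S \<rightarrow>\<^sub>M prob_algebra A"
      using \<pi> by (simp add: policies_def history_space_def)
    have state: "(\<lambda>\<omega>. if t = 0 then return S s else Q (\<omega> (t - 1)))
        \<in> PiM {0..<t} (\<lambda>_. S \<Otimes>\<^sub>M A) \<rightarrow>\<^sub>M prob_algebra S"
    proof (cases "t = 0")
      case True
      have "return S s \<in> space (prob_algebra S)"
        using s by (simp add: space_prob_algebra prob_space_return)
      then show ?thesis using True by simp
    next
      case False
      then have "(\<lambda>\<omega>. \<omega> (t - 1)) \<in> PiM {0..<t} (\<lambda>_. S \<Otimes>\<^sub>M A) \<rightarrow>\<^sub>M S \<Otimes>\<^sub>M A"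
        by (intro measurable_component_singleton) auto
      from measurable_compose[OF this Q] False show ?thesis by simp
    qed
    show ?thesis
      unfolding mdp_step_def[abs_def]
      by (rule measurable_bind_prob_space2[OF state]) (measurable)
  qed
  show ?thesis
  proof (rule Ionescu_Tulcea.intro)
    fix i
    show "mdp_step S A Q \<pi> s i \<in> PiM {0..<i} (\<lambda>_. S \<Otimes>\<^sub>M A) \<rightarrow>\<^sub>M subprob_algebra (S \<Otimes>\<^sub>M A)"
      by (rule measurable_prob_algebraD[OF step])
  next
    fix i :: nat and \<omega> assume "\<omega> \<in> space (PiM {0..<i} (\<lambda>_. S \<Otimes>\<^sub>M A))"
    from measurable_space[OF step this] show "prob_space (mdp_step S A Q \<pi> s i \<omega>)"
      by (simp add: space_prob_algebra)
  qed
qed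

lemma stationary_policy_in_policies:
  assumes [measurable]: "\<phi> \<in> S \<rightarrow>\<^sub>M A"
  shows "stationary_policy A \<phi> \<in> policies S A"
proof -
  have "(\<lambda>h. return A (\<phi> (snd h))) \<in> history_space S A t \<rightarrow>\<^sub>M prob_algebra A" for t
    unfolding history_space_def by measurable
  then show ?thesis
    by (simp add: policies_def stationary_policy_def[abs_def])
qed


section \<open>The restart problem\<close>

primrec kernel_power :: "'x measure \<Rightarrow> ('x \<Rightarrow> 'x measure) \<Rightarrow> nat \<Rightarrow> 'x \<Rightarrow> 'x measure" where
  "kernel_power M P 0 x = return M x"
| "kernel_power M P (Suc k) x = kernel_power M P k x \<bind> P"

definition kernel_apply :: "('x \<Rightarrow> 'x measure) \<Rightarrow> ('x \<Rightarrow> ennreal) \<Rightarrow> 'x \<Rightarrow> ennreal" where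
  "kernel_apply K F x = (\<integral>\<^sup>+y. F y \<partial>K x)"

datatype action = No_Intervention | Restart

abbreviation action_space :: "action measure" where
  "action_space \<equiv> count_space UNIV"

definition restart_state_space :: "'x measure \<Rightarrow> ('x \<times> nat) measure" where
  "restart_state_space M = M \<Otimes>\<^sub>M count_space UNIV"

fun restart_kernel :: "'x measure \<Rightarrow> 'x measure \<Rightarrow> ('x \<times> nat) \<times> action \<Rightarrow> ('x \<times> nat) measure" where
  "restart_kernel M \<nu> ((x, k), No_Intervention) = return M x \<Otimes>\<^sub>M return (count_space UNIV) (k + 1)"
| "restart_kernel M \<nu> ((x, k), Restart) = \<nu> \<Otimes>\<^sub>M return (count_space UNIV) 0"

fun restart_cost ::
  "'x measure \<Rightarrow> ('x \<Rightarrow> 'x measure) \<Rightarrow> ('x \<Rightarrow> ennreal) \<Rightarrow> (action \<Rightarrow> real)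
    \<Rightarrow> ('x \<times> nat) \<times> action \<Rightarrow> ennreal" where
  "restart_cost M P F G ((x, k), a) = kernel_apply (kernel_power M P k) F x + ennreal (G a)"

lemma measurable_restart_kernel:
  fixes M \<nu> :: "'x measure"
  assumes \<nu>: "\<nu> \<in> space (prob_algebra M)"
  shows "restart_kernel M \<nu> \<in> restart_state_space M \<Otimes>\<^sub>M action_space
    \<rightarrow>\<^sub>M prob_algebra (restart_state_space M)"
proof -
  have [measurable]: "(\<lambda>_. \<nu>) \<in> N \<rightarrow>\<^sub>M prob_algebra M" for N :: "'z measure"
    using \<nu> by simp
  have n: "(\<lambda>p. return M (fst (fst p)) \<Otimes>\<^sub>M return (count_space UNIV) (snd (fst p) + 1))
      \<in> (M \<Otimes>\<^sub>M count_space (UNIV :: nat set)) \<Otimes>\<^sub>M action_space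
        \<rightarrow>\<^sub>M prob_algebra (M \<Otimes>\<^sub>M count_space UNIV)"
    by measurable
  have r: "(\<lambda>p. \<nu> \<Otimes>\<^sub>M return (count_space UNIV) (0 :: nat))
      \<in> (M \<Otimes>\<^sub>M count_space (UNIV :: nat set)) \<Otimes>\<^sub>M action_space
        \<rightarrow>\<^sub>M prob_algebra (M \<Otimes>\<^sub>M count_space UNIV)"
    by measurable
  have eq: "restart_kernel M \<nu> = (\<lambda>p. if snd p = No_Intervention
      then return M (fst (fst p)) \<Otimes>\<^sub>M return (count_space UNIV) (snd (fst p) + 1)
      else \<nu> \<Otimes>\<^sub>M return (count_space UNIV) 0)"
  proof
    fix p :: "('x \<times> nat) \<times> action"
    obtain x k a where "p = ((x, k), a)" by (metis prod.exhaust)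
    then show "restart_kernel M \<nu> p = (if snd p = No_Intervention
      then return M (fst (fst p)) \<Otimes>\<^sub>M return (count_space UNIV) (snd (fst p) + 1)
      else \<nu> \<Otimes>\<^sub>M return (count_space UNIV) 0)"
      by (cases a) simp_all
  qed
  show ?thesis
    unfolding eq restart_state_space_def by (rule measurable_If[OF n r]) measurable
qed

definition restart_policy_value ::
  "'x measure \<Rightarrow> ('x \<Rightarrow> 'x measure) \<Rightarrow> 'x measure \<Rightarrow> ('x \<Rightarrow> ennreal) \<Rightarrow> (action \<Rightarrow> real) \<Rightarrow> real
    \<Rightarrow> ('x \<times> nat, action) policy \<Rightarrow> 'x \<times> nat \<Rightarrow> ennreal" where
  "restart_policy_value M P \<nu> F G \<gamma> =
     policy_value (restart_state_space M) action_space (restart_kernel M \<nu>) (restart_cost M P F G) \<gamma>"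

definition restart_value ::
  "'x measure \<Rightarrow> ('x \<Rightarrow> 'x measure) \<Rightarrow> 'x measure \<Rightarrow> ('x \<Rightarrow> ennreal) \<Rightarrow> (action \<Rightarrow> real) \<Rightarrow> real
    \<Rightarrow> 'x \<times> nat \<Rightarrow> ennreal" where
  "restart_value M P \<nu> F G \<gamma> =
     optimal_value (restart_state_space M) action_space (restart_kernel M \<nu>) (restart_cost M P F G) \<gamma>"

definition restart_level ::
  "'x measure \<Rightarrow> ('x \<Rightarrow> 'x measure) \<Rightarrow> 'x measure \<Rightarrow> ('x \<Rightarrow> ennreal) \<Rightarrow> (action \<Rightarrow> real) \<Rightarrow> real
    \<Rightarrow> ennreal" where
  "restart_level M P \<nu> F G \<gamma> =
     ennreal (G Restart) + ennreal \<gamma> * (\<integral>\<^sup>+z. restart_value M P \<nu> F G \<gamma> (z, 0) \<partial>\<nu>)"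

text \<open>The infimum is taken in \<^typ>\<open>enat\<close>, so that \<open>Inf {} = \<infinity>\<close>.\<close>

definition threshold_index ::
  "'x measure \<Rightarrow> ('x \<Rightarrow> 'x measure) \<Rightarrow> 'x measure \<Rightarrow> ('x \<Rightarrow> ennreal) \<Rightarrow> (action \<Rightarrow> real) \<Rightarrow> real
    \<Rightarrow> 'x \<Rightarrow> enat" where
  "threshold_index M P \<nu> F G \<gamma> x =
     Inf {enat k | k. restart_level M P \<nu> F G \<gamma>
        \<le> ennreal (G No_Intervention) + ennreal \<gamma> * restart_value M P \<nu> F G \<gamma> (x, k + 1)}"

definition always_n :: "('x \<times> nat, action) policy" where
  "always_n = stationary_policy action_space (\<lambda>(y, k). No_Intervention)"

end

theory Submission
  imports Defs
begin

text \<open>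
  Write \<open>f\<^sub>k = P\<^sup>k F\<close>, which increases to \<open>L\<close>. Conditioning on the first stage gives
  \<open>V (y, k) \<ge> f\<^sub>k y + min (G n + \<gamma> V (y, k + 1)) A\<close>, and the always-\<open>n\<close> value is
  \<open>U (y, k) = (\<Sum>t. \<gamma>\<^sup>t (f\<^bsub>k+t\<^esub> y + G n))\<close>. If the minimum is attained by its first argument for
  all \<open>k\<close>, iteration yields \<open>V (y, k) \<ge> U (y, k)\<close>. This applies at a point \<open>x\<close> with infinite
  threshold, where \<open>U (x, k)\<close> tends to \<open>W = (L + G n) / (1 - \<gamma>)\<close>, so that \<open>G n + \<gamma> W \<le> A\<close>.
  But \<open>V \<le> U \<le> W\<close> everywhere, hence the minimum is attained by its first argument at every state.
\<close>

section \<open>First-step decomposition of policy values\<close>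

definition shift_policy :: "'s \<times> 'a \<Rightarrow> ('s, 'a) policy \<Rightarrow> ('s, 'a) policy" where
  "shift_policy p \<pi> t h = \<pi> (Suc t) (case_nat p (fst h), snd h)"

locale discrete_action_mdp =
  fixes S :: "'s measure" and A :: "'a measure" and Q :: "'s \<times> 'a \<Rightarrow> 's measure"
  assumes A: "A = count_space UNIV"
    and Q[measurable]: "Q \<in> S \<Otimes>\<^sub>M A \<rightarrow>\<^sub>M prob_algebra S"
begin

abbreviation hist :: "nat \<Rightarrow> (nat \<Rightarrow> 's \<times> 'a) measure" where
  "hist t \<equiv> PiM {0..<t} (\<lambda>_. S \<Otimes>\<^sub>M A)"

text \<open>
  The integral of \<open>g\<close> over the law of the first \<open>n\<close> stages, as an iterated integral. With this
  form, moving the first stage to the outside needs only pointwise equality of integrands.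
\<close>

primrec path_integral ::
  "('s, 'a) policy \<Rightarrow> 's \<Rightarrow> nat \<Rightarrow> ((nat \<Rightarrow> 's \<times> 'a) \<Rightarrow> ennreal) \<Rightarrow> ennreal" where
  "path_integral \<pi> s 0 g = g (\<lambda>_. undefined)"
| "path_integral \<pi> s (Suc n) g =
     path_integral \<pi> s n (\<lambda>\<omega>. \<integral>\<^sup>+p. g (fun_upd \<omega> n p) \<partial>mdp_step S A Q \<pi> s n \<omega>)"

lemma space_A[simp]: "space A = UNIV" and sets_A[simp]: "sets A = UNIV"
  by (simp_all add: A)

lemma measurable_policy:
  "\<pi> \<in> policies S A \<Longrightarrow> \<pi> t \<in> hist t \<Otimes>\<^sub>M S \<rightarrow>\<^sub>M prob_algebra A"
  by (simp add: policies_def history_space_def)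

lemma measurable_mdp_step:
  assumes "\<pi> \<in> policies S A" "s \<in> space S"
  shows "mdp_step S A Q \<pi> s t \<in> hist t \<rightarrow>\<^sub>M subprob_algebra (S \<Otimes>\<^sub>M A)"
  using Ionescu_Tulcea_mdp_step[OF Q assms] by (rule Ionescu_Tulcea.P)

lemma measurable_fun_upd_hist:
  "(\<lambda>(\<omega>, p). fun_upd \<omega> n p) \<in> hist n \<Otimes>\<^sub>M (S \<Otimes>\<^sub>M A) \<rightarrow>\<^sub>M hist (Suc n)"
  unfolding split_beta'
  by (rule measurable_fun_upd[where J="{0..<n}"]) (auto simp: atLeastLessThanSuc)

lemma measurable_step_integral:
  assumes "\<pi> \<in> policies S A" "s \<in> space S" and [measurable]: "g \<in> borel_measurable (hist (Suc n))"
  shows "(\<lambda>\<omega>. \<integral>\<^sup>+p. g (fun_upd \<omega> n p) \<partial>mdp_step S A Q \<pi> s n \<omega>) \<in> borel_measurable (hist n)"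
proof (rule nn_integral_measurable_subprob_algebra2[OF _ measurable_mdp_step[OF assms(1,2)]])
  show "(\<lambda>(\<omega>, p). g (fun_upd \<omega> n p)) \<in> borel_measurable (hist n \<Otimes>\<^sub>M (S \<Otimes>\<^sub>M A))"
    using measurable_compose[OF measurable_fun_upd_hist assms(3)] by (simp add: split_beta')
qed

lemma nn_integral_bind_policy:
  assumes \<pi>: "\<pi> \<in> policies S A" and \<omega>: "\<omega> \<in> space (hist t)"
    and D: "D \<in> space (prob_algebra S)" and f[measurable]: "f \<in> borel_measurable (S \<Otimes>\<^sub>M A)"
  shows "(\<integral>\<^sup>+p. f p \<partial>(D \<bind> (\<lambda>s'. \<pi> t (\<omega>, s') \<bind> (\<lambda>a. return (S \<Otimes>\<^sub>M A) (s', a)))))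
    = (\<integral>\<^sup>+s'. \<integral>\<^sup>+a. f (s', a) \<partial>\<pi> t (\<omega>, s') \<partial>D)"
proof -
  have setsD[measurable_cong]: "sets D = sets S" and "space D = space S"
    using D by (auto simp: space_prob_algebra dest: sets_eq_imp_space_eq)
  note [measurable] = measurable_policy[OF \<pi>]
  have [measurable]: "(\<lambda>s'. \<pi> t (\<omega>, s')) \<in> S \<rightarrow>\<^sub>M prob_algebra A"
    using \<omega> by measurable
  have "(\<integral>\<^sup>+p. f p \<partial>(D \<bind> (\<lambda>s'. \<pi> t (\<omega>, s') \<bind> (\<lambda>a. return (S \<Otimes>\<^sub>M A) (s', a)))))
    = (\<integral>\<^sup>+s'. \<integral>\<^sup>+p. f p \<partial>(\<pi> t (\<omega>, s') \<bind> (\<lambda>a. return (S \<Otimes>\<^sub>M A) (s', a))) \<partial>D)"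
    by (rule nn_integral_bind[OF f])
      (rule measurable_prob_algebraD, rule measurable_bind_prob_space2[where N=A], measurable)
  also have "\<dots> = (\<integral>\<^sup>+s'. \<integral>\<^sup>+a. f (s', a) \<partial>\<pi> t (\<omega>, s') \<partial>D)"
  proof (rule nn_integral_cong)
    fix s' assume "s' \<in> space D"
    then have s': "s' \<in> space S" using \<open>space D = space S\<close> by simp
    have sp: "sets (\<pi> t (\<omega>, s')) = UNIV"
      using measurable_space[OF \<open>(\<lambda>s'. \<pi> t (\<omega>, s')) \<in> S \<rightarrow>\<^sub>M prob_algebra A\<close> s']
      by (simp add: space_prob_algebra)
    then have sets\<pi>[measurable_cong]: "sets (\<pi> t (\<omega>, s')) = sets A" by simp
    have "(\<lambda>a. return (S \<Otimes>\<^sub>M A) (s', a)) \<in> A \<rightarrow>\<^sub>M prob_algebra (S \<Otimes>\<^sub>M A)"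
      using s' by measurable
    then have "(\<lambda>a. return (S \<Otimes>\<^sub>M A) (s', a)) \<in> \<pi> t (\<omega>, s') \<rightarrow>\<^sub>M subprob_algebra (S \<Otimes>\<^sub>M A)"
      by (simp add: measurable_prob_algebraD cong: measurable_cong_sets[OF sets\<pi> refl])
    then have "(\<integral>\<^sup>+p. f p \<partial>(\<pi> t (\<omega>, s') \<bind> (\<lambda>a. return (S \<Otimes>\<^sub>M A) (s', a))))
       = (\<integral>\<^sup>+a. \<integral>\<^sup>+p. f p \<partial>return (S \<Otimes>\<^sub>M A) (s', a) \<partial>\<pi> t (\<omega>, s'))"
      by (rule nn_integral_bind[OF f])
    also have "\<dots> = (\<integral>\<^sup>+a. f (s', a) \<partial>\<pi> t (\<omega>, s'))"
      using s' by (intro nn_integral_cong nn_integral_return f) (auto simp: space_pair_measure)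
    finally show "(\<integral>\<^sup>+p. f p \<partial>(\<pi> t (\<omega>, s') \<bind> (\<lambda>a. return (S \<Otimes>\<^sub>M A) (s', a))))
       = (\<integral>\<^sup>+a. f (s', a) \<partial>\<pi> t (\<omega>, s'))" .
  qed
  finally show ?thesis .
qed

lemma nn_integral_mdp_step_0:
  assumes \<pi>: "\<pi> \<in> policies S A" and s: "s \<in> space S" and f[measurable]: "f \<in> borel_measurable (S \<Otimes>\<^sub>M A)"
  shows "(\<integral>\<^sup>+p. f p \<partial>mdp_step S A Q \<pi> s 0 (\<lambda>_. undefined))
    = (\<integral>\<^sup>+a. f (s, a) \<partial>\<pi> 0 (\<lambda>_. undefined, s))"
proof -
  note [measurable] = measurable_policy[OF \<pi>]
  have u[measurable]: "(\<lambda>_. undefined) \<in> space (hist 0)" by (simp add: space_PiM)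
  have pm[measurable]: "(\<lambda>s'. \<pi> 0 (\<lambda>_. undefined, s')) \<in> S \<rightarrow>\<^sub>M prob_algebra A"
    using u by measurable
  have "(\<lambda>s'. \<integral>\<^sup>+a. f (s', a) \<partial>\<pi> 0 (\<lambda>_. undefined, s')) \<in> borel_measurable S"
    by (rule nn_integral_measurable_subprob_algebra2[OF _ measurable_prob_algebraD[OF pm]]) measurable
  then show ?thesis
    using s nn_integral_bind_policy[OF \<pi> u _ f, of "return S s"]
    by (simp add: mdp_step_def space_prob_algebra prob_space_return nn_integral_return)
qed

lemma nn_integral_mdp_step_Suc:
  assumes \<pi>: "\<pi> \<in> policies S A" and \<omega>: "\<omega> \<in> space (hist (Suc t))"
    and f: "f \<in> borel_measurable (S \<Otimes>\<^sub>M A)"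
  shows "(\<integral>\<^sup>+p. f p \<partial>mdp_step S A Q \<pi> s (Suc t) \<omega>)
    = (\<integral>\<^sup>+s'. \<integral>\<^sup>+a. f (s', a) \<partial>\<pi> (Suc t) (\<omega>, s') \<partial>Q (\<omega> t))"
proof -
  have "\<omega> t \<in> space (S \<Otimes>\<^sub>M A)"
    using \<omega> by (auto simp: space_PiM PiE_iff)
  then have "Q (\<omega> t) \<in> space (prob_algebra S)"
    by (rule measurable_space[OF Q])
  from nn_integral_bind_policy[OF \<pi> \<omega> this f] show ?thesis
    by (simp add: mdp_step_def)
qed

lemma path_integral_eq_C:
  assumes \<pi>: "\<pi> \<in> policies S A" and s: "s \<in> space S" and g: "g \<in> borel_measurable (hist n)"
  shows "path_integral \<pi> s n g
    = (\<integral>\<^sup>+\<omega>. g \<omega> \<partial>Ionescu_Tulcea.C (mdp_step S A Q \<pi> s) (\<lambda>_. S \<Otimes>\<^sub>M A) 0 n (\<lambda>_. undefined))"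
proof -
  interpret IT: Ionescu_Tulcea "mdp_step S A Q \<pi> s" "\<lambda>_. S \<Otimes>\<^sub>M A"
    by (rule Ionescu_Tulcea_mdp_step[OF Q \<pi> s])
  have u: "(\<lambda>_. undefined) \<in> space (hist 0)" by (simp add: space_PiM)
  show ?thesis
    using g
  proof (induction n arbitrary: g)
    case 0
    then show ?case using nn_integral_return[OF u] by simp
  next
    case (Suc n)
    have sp: "space (IT.C 0 n (\<lambda>_. undefined)) = space (hist n)"
      using IT.space_C[OF u, of n] by simp
    have "(\<integral>\<^sup>+\<omega>. g \<omega> \<partial>IT.C 0 (Suc n) (\<lambda>_. undefined))
      = (\<integral>\<^sup>+\<omega>. \<integral>\<^sup>+\<omega>'. g \<omega>' \<partial>IT.eP n \<omega> \<partial>IT.C 0 n (\<lambda>_. undefined))"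
      using IT.sets_C[OF u, of n] Suc.prems
      by (simp add: nn_integral_bind[where B="hist (Suc n)"] cong: measurable_cong_sets)
    also have "\<dots> = (\<integral>\<^sup>+\<omega>. \<integral>\<^sup>+p. g (fun_upd \<omega> n p) \<partial>mdp_step S A Q \<pi> s n \<omega> \<partial>IT.C 0 n (\<lambda>_. undefined))"
      by (intro nn_integral_cong IT.nn_integral_eP Suc.prems) (simp add: sp)
    also have "\<dots> = path_integral \<pi> s (Suc n) g"
      by (simp only: path_integral.simps(2) Suc.IH[OF measurable_step_integral[OF \<pi> s Suc.prems]])
    finally show ?case ..
  qed
qed

lemma nn_integral_mdp_measure_prefix:
  assumes \<pi>: "\<pi> \<in> policies S A" and s: "s \<in> space S" and g: "g \<in> borel_measurable (hist n)"
  shows "(\<integral>\<^sup>+\<omega>. g (restrict \<omega> {0..<n}) \<partial>mdp_measure S A Q \<pi> s) = path_integral \<pi> s n g"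
proof -
  interpret IT: Ionescu_Tulcea "mdp_step S A Q \<pi> s" "\<lambda>_. S \<Otimes>\<^sub>M A"
    by (rule Ionescu_Tulcea_mdp_step[OF Q \<pi> s])
  have u: "(\<lambda>_. undefined) \<in> space (hist 0)" by (simp add: space_PiM)
  have up: "IT.up_to {0..<n} = n"
  proof (rule antisym)
    show "IT.up_to {0..<n} \<le> n" by (simp add: IT.up_to_iff_Ico)
    show "n \<le> IT.up_to {0..<n}"
      using IT.up_to_less[of "{0..<n}" "IT.up_to {0..<n}"] by (auto intro: ccontr)
  qed
  have "(\<lambda>x. restrict x {0..<n}) \<in> IT.PF.lim \<rightarrow>\<^sub>M hist n"
    by (subst measurable_cong_sets[OF IT.PF.sets_lim refl]) (rule measurable_restrict_subset, simp)
  then have "(\<integral>\<^sup>+\<omega>. g (restrict \<omega> {0..<n}) \<partial>mdp_measure S A Q \<pi> s)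
     = (\<integral>\<^sup>+\<omega>. g \<omega> \<partial>distr IT.PF.lim (hist n) (\<lambda>x. restrict x {0..<n}))"
    by (simp add: mdp_measure_def nn_integral_distr g)
  also have "\<dots> = (\<integral>\<^sup>+\<omega>. g \<omega> \<partial>IT.CI {0..<n})"
    by (simp add: IT.distr_lim)
  also have "IT.CI {0..<n} = IT.C 0 n (\<lambda>_. undefined)"
    using IT.distr_C[OF order_refl u, of n] by (simp add: IT.CI_def up)
  finally show ?thesis
    by (simp only: path_integral_eq_C[OF \<pi> s g])
qed

lemma measurable_case_nat_hist:
  assumes p: "p \<in> space (S \<Otimes>\<^sub>M A)"
  shows "case_nat p \<in> hist t \<rightarrow>\<^sub>M hist (Suc t)"
proof (rule measurable_PiM_single')
  fix i assume i: "i \<in> {0..<Suc t}"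
  show "(\<lambda>\<omega>. case_nat p \<omega> i) \<in> hist t \<rightarrow>\<^sub>M S \<Otimes>\<^sub>M A"
    using i p by (cases i) (auto intro: measurable_component_singleton)
next
  show "case_nat p \<in> space (hist t) \<rightarrow> (\<Pi>\<^sub>E i\<in>{0..<Suc t}. space (S \<Otimes>\<^sub>M A))"
    using p by (auto simp: space_PiM PiE_iff extensional_def split: nat.split)
qed

lemma shift_policy_in_policies:
  assumes \<pi>: "\<pi> \<in> policies S A" and p: "p \<in> space (S \<Otimes>\<^sub>M A)"
  shows "shift_policy p \<pi> \<in> policies S A"
proof -
  have "shift_policy p \<pi> t \<in> hist t \<Otimes>\<^sub>M S \<rightarrow>\<^sub>M prob_algebra A" for t
  proof -
    have "(\<lambda>h. (case_nat p (fst h), snd h)) \<in> hist t \<Otimes>\<^sub>M S \<rightarrow>\<^sub>M hist (Suc t) \<Otimes>\<^sub>M S"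
      by (intro measurable_Pair measurable_compose[OF measurable_fst measurable_case_nat_hist[OF p]] measurable_snd)
    from measurable_compose[OF this measurable_policy[OF \<pi>]] show ?thesis
      by (simp add: shift_policy_def[abs_def])
  qed
  then show ?thesis by (simp add: policies_def history_space_def)
qed

lemma path_integral_1:
  assumes \<pi>: "\<pi> \<in> policies S A" and s: "s \<in> space S" and g: "g \<in> borel_measurable (hist (Suc 0))"
  shows "path_integral \<pi> s (Suc 0) g
    = (\<integral>\<^sup>+a. g (fun_upd (\<lambda>_. undefined) 0 (s, a)) \<partial>\<pi> 0 (\<lambda>_. undefined, s))"
proof -
  have u: "(\<lambda>_. undefined) \<in> space (hist 0)" by (simp add: space_PiM)
  have "(\<lambda>p. g (fun_upd (\<lambda>_. undefined) 0 p)) \<in> borel_measurable (S \<Otimes>\<^sub>M A)"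
    using measurable_compose[OF measurable_compose[OF measurable_Pair1'[OF u] measurable_fun_upd_hist] g]
    by (simp only: prod.case)
  from nn_integral_mdp_step_0[OF \<pi> s this] show ?thesis by simp
qed

lemma mdp_step_Suc_initial: "mdp_step S A Q \<pi> s (Suc n) = mdp_step S A Q \<pi> s' (Suc n)"
  by (simp add: mdp_step_def[abs_def])

lemma measurable_path_integral:
  assumes \<pi>: "\<pi> \<in> policies S A" and g: "g \<in> borel_measurable (hist (Suc n))"
  shows "(\<lambda>s. path_integral \<pi> s (Suc n) g) \<in> borel_measurable S"
  using g
proof (induction n arbitrary: g)
  case 0
  note [measurable] = measurable_policy[OF \<pi>]
  have u[measurable]: "(\<lambda>_. undefined) \<in> space (hist 0)" by (simp add: space_PiM)
  have pm: "(\<lambda>s'. \<pi> 0 (\<lambda>_. undefined, s')) \<in> S \<rightarrow>\<^sub>M prob_algebra A"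
    using u by measurable
  have gm[measurable]: "(\<lambda>p. g (fun_upd (\<lambda>_. undefined) 0 p)) \<in> borel_measurable (S \<Otimes>\<^sub>M A)"
    using measurable_compose[OF measurable_compose[OF measurable_Pair1'[OF u] measurable_fun_upd_hist] 0]
    by (simp only: prod.case)
  have "(\<lambda>s. \<integral>\<^sup>+a. g (fun_upd (\<lambda>_. undefined) 0 (s, a)) \<partial>\<pi> 0 (\<lambda>_. undefined, s)) \<in> borel_measurable S"
    by (rule nn_integral_measurable_subprob_algebra2[OF _ measurable_prob_algebraD[OF pm]]) measurable
  also have "?this \<longleftrightarrow> ?case"
    by (intro measurable_cong) (simp only: path_integral_1[OF \<pi> _ 0])
  finally show ?case .
next
  case (Suc n)
  show ?case
  proof (cases "space S = {}")
    case True
    then show ?thesis by (simp add: measurable_def)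
  next
    case False
    then obtain s\<^sub>0 where s\<^sub>0: "s\<^sub>0 \<in> space S" by auto
    have eq: "path_integral \<pi> s (Suc (Suc n)) g = path_integral \<pi> s (Suc n)
       (\<lambda>\<omega>. \<integral>\<^sup>+p. g (fun_upd \<omega> (Suc n) p) \<partial>mdp_step S A Q \<pi> s\<^sub>0 (Suc n) \<omega>)" for s
      by (simp only: path_integral.simps(2)[of \<pi> s "Suc n" g] mdp_step_Suc_initial[of \<pi> s n s\<^sub>0])
    show ?thesis
      unfolding eq by (rule Suc.IH[OF measurable_step_integral[OF \<pi> s\<^sub>0 Suc.prems]])
  qed
qed

lemma case_nat_fun_upd: "fun_upd (case_nat q \<omega>) (Suc n) p = case_nat q (fun_upd \<omega> n p)"
  by (auto simp: fun_eq_iff split: nat.split)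

lemma case_nat_undefined: "case_nat q (\<lambda>_. undefined) = fun_upd (\<lambda>_. undefined) 0 q"
  by (auto simp: fun_eq_iff split: nat.split)

lemma mdp_step_shift:
  "mdp_step S A Q \<pi> s (Suc (Suc n)) (case_nat q \<omega>) = mdp_step S A Q (shift_policy q \<pi>) s' (Suc n) \<omega>"
  by (simp add: mdp_step_def shift_policy_def)

lemma path_integral_shift:
  assumes \<pi>: "\<pi> \<in> policies S A" and s: "s \<in> space S" and g: "g \<in> borel_measurable (hist (Suc (Suc n)))"
  shows "path_integral \<pi> s (Suc (Suc n)) g = (\<integral>\<^sup>+a. \<integral>\<^sup>+s'.
      path_integral (shift_policy (s, a) \<pi>) s' (Suc n) (\<lambda>\<omega>. g (case_nat (s, a) \<omega>))
      \<partial>Q (s, a) \<partial>\<pi> 0 (\<lambda>_. undefined, s))"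
  using g
proof (induction n arbitrary: g)
  case 0
  let ?u = "(\<lambda>_. undefined) :: nat \<Rightarrow> 's \<times> 'a"
  have u: "?u \<in> space (hist 0)" by (simp add: space_PiM)
  have "path_integral \<pi> s (Suc (Suc 0)) g = path_integral \<pi> s (Suc 0)
       (\<lambda>\<omega>. \<integral>\<^sup>+p. g (fun_upd \<omega> (Suc 0) p) \<partial>mdp_step S A Q \<pi> s (Suc 0) \<omega>)"
    by (rule path_integral.simps(2))
  also have "\<dots> = (\<integral>\<^sup>+a. \<integral>\<^sup>+p. g (fun_upd (fun_upd ?u 0 (s, a)) (Suc 0) p)
       \<partial>mdp_step S A Q \<pi> s (Suc 0) (fun_upd ?u 0 (s, a)) \<partial>\<pi> 0 (?u, s))"
    by (rule path_integral_1[OF \<pi> s measurable_step_integral[OF \<pi> s 0]])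
  also have "\<dots> = (\<integral>\<^sup>+a. \<integral>\<^sup>+s'.
      path_integral (shift_policy (s, a) \<pi>) s' (Suc 0) (\<lambda>\<omega>. g (case_nat (s, a) \<omega>))
      \<partial>Q (s, a) \<partial>\<pi> 0 (?u, s))"
  proof (rule nn_integral_cong)
    fix a :: 'a
    let ?q = "(s, a)"
    have q: "?q \<in> space (S \<Otimes>\<^sub>M A)" using s by (simp add: space_pair_measure)
    have hq: "fun_upd ?u 0 ?q \<in> space (hist (Suc 0))"
      using measurable_space[OF measurable_case_nat_hist[OF q] u] by (simp only: case_nat_undefined)
    have gc: "(\<lambda>\<omega>. g (case_nat ?q \<omega>)) \<in> borel_measurable (hist (Suc 0))"
      by (rule measurable_compose[OF measurable_case_nat_hist[OF q] 0])
    have gm: "(\<lambda>p. g (fun_upd (fun_upd ?u 0 ?q) (Suc 0) p)) \<in> borel_measurable (S \<Otimes>\<^sub>M A)"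
      using measurable_compose[OF measurable_compose[OF measurable_Pair1'[OF hq] measurable_fun_upd_hist] 0]
      by (simp only: prod.case)
    have "Q ?q \<in> space (prob_algebra S)" by (rule measurable_space[OF Q q])
    then have spQ: "space (Q ?q) = space S"
      by (auto simp: space_prob_algebra dest: sets_eq_imp_space_eq)
    have "(\<integral>\<^sup>+p. g (fun_upd (fun_upd ?u 0 ?q) (Suc 0) p)
       \<partial>mdp_step S A Q \<pi> s (Suc 0) (fun_upd ?u 0 ?q))
      = (\<integral>\<^sup>+s'. \<integral>\<^sup>+a'. g (fun_upd (fun_upd ?u 0 ?q) (Suc 0) (s', a'))
          \<partial>\<pi> (Suc 0) (fun_upd ?u 0 ?q, s') \<partial>Q (fun_upd ?u 0 ?q 0))"
      by (rule nn_integral_mdp_step_Suc[OF \<pi> hq gm])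
    also have "\<dots> = (\<integral>\<^sup>+s'. path_integral (shift_policy ?q \<pi>) s' (Suc 0) (\<lambda>\<omega>. g (case_nat ?q \<omega>)) \<partial>Q ?q)"
      unfolding fun_upd_same
      by (intro nn_integral_cong, subst path_integral_1[OF shift_policy_in_policies[OF \<pi> q] _ gc])
         (simp_all add: spQ shift_policy_def case_nat_undefined flip: case_nat_fun_upd)
    finally show "(\<integral>\<^sup>+p. g (fun_upd (fun_upd ?u 0 ?q) (Suc 0) p)
       \<partial>mdp_step S A Q \<pi> s (Suc 0) (fun_upd ?u 0 ?q))
      = (\<integral>\<^sup>+s'. path_integral (shift_policy ?q \<pi>) s' (Suc 0) (\<lambda>\<omega>. g (case_nat ?q \<omega>)) \<partial>Q ?q)" .
  qed
  finally show ?case .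
next
  case (Suc n)
  let ?g = "\<lambda>\<omega>. \<integral>\<^sup>+p. g (fun_upd \<omega> (Suc (Suc n)) p) \<partial>mdp_step S A Q \<pi> s (Suc (Suc n)) \<omega>"
  have "path_integral \<pi> s (Suc (Suc (Suc n))) g = path_integral \<pi> s (Suc (Suc n)) ?g"
    by (rule path_integral.simps(2))
  also have "\<dots> = (\<integral>\<^sup>+a. \<integral>\<^sup>+s'.
      path_integral (shift_policy (s, a) \<pi>) s' (Suc n) (\<lambda>\<omega>. ?g (case_nat (s, a) \<omega>))
      \<partial>Q (s, a) \<partial>\<pi> 0 (\<lambda>_. undefined, s))"
    by (rule Suc.IH[OF measurable_step_integral[OF \<pi> s Suc.prems]])
  also have "\<dots> = (\<integral>\<^sup>+a. \<integral>\<^sup>+s'.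
      path_integral (shift_policy (s, a) \<pi>) s' (Suc (Suc n)) (\<lambda>\<omega>. g (case_nat (s, a) \<omega>))
      \<partial>Q (s, a) \<partial>\<pi> 0 (\<lambda>_. undefined, s))"
  proof (intro nn_integral_cong)
    fix a s'
    show "path_integral (shift_policy (s, a) \<pi>) s' (Suc n) (\<lambda>\<omega>. ?g (case_nat (s, a) \<omega>))
      = path_integral (shift_policy (s, a) \<pi>) s' (Suc (Suc n)) (\<lambda>\<omega>. g (case_nat (s, a) \<omega>))"
      by (simp only: path_integral.simps(2)[of _ _ "Suc n"] case_nat_fun_upd
          mdp_step_shift[where s = s and s' = s'])
  qed
  finally show ?case .
qed

lemma measurable_cost:
  assumes c: "c \<in> borel_measurable (S \<Otimes>\<^sub>M A)"
  shows "(\<lambda>\<omega>. c (\<omega> t)) \<in> borel_measurable (hist (Suc t))"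
  using measurable_compose[OF measurable_component_singleton[of t "{0..<Suc t}" "\<lambda>_. S \<Otimes>\<^sub>M A"] c] by simp

lemma policy_value_eq_suminf:
  assumes \<pi>: "\<pi> \<in> policies S A" and s: "s \<in> space S" and c[measurable]: "c \<in> borel_measurable (S \<Otimes>\<^sub>M A)"
  shows "policy_value S A Q c \<gamma> \<pi> s
    = (\<Sum>t. ennreal (\<gamma> ^ t) * path_integral \<pi> s (Suc t) (\<lambda>\<omega>. c (\<omega> t)))"
proof -
  interpret IT: Ionescu_Tulcea "mdp_step S A Q \<pi> s" "\<lambda>_. S \<Otimes>\<^sub>M A"
    by (rule Ionescu_Tulcea_mdp_step[OF Q \<pi> s])
  have [measurable_cong]: "sets (mdp_measure S A Q \<pi> s) = sets (PiM UNIV (\<lambda>_. S \<Otimes>\<^sub>M A))"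
    by (simp add: mdp_measure_def)
  have "(\<integral>\<^sup>+\<omega>. ennreal (\<gamma> ^ t) * c (\<omega> t) \<partial>mdp_measure S A Q \<pi> s)
    = ennreal (\<gamma> ^ t) * path_integral \<pi> s (Suc t) (\<lambda>\<omega>. c (\<omega> t))" for t
  proof -
    from nn_integral_mdp_measure_prefix[OF \<pi> s measurable_cost[OF c]]
    show ?thesis by (simp add: nn_integral_cmult)
  qed
  then show ?thesis
    by (simp add: policy_value_def nn_integral_suminf)
qed

lemma policy_value_first_step:
  assumes \<pi>: "\<pi> \<in> policies S A" and s: "s \<in> space S" and c[measurable]: "c \<in> borel_measurable (S \<Otimes>\<^sub>M A)"
    and \<gamma>: "0 \<le> \<gamma>"
  shows "policy_value S A Q c \<gamma> \<pi> s = (\<integral>\<^sup>+a. c (s, a) + ennreal \<gamma> *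
      (\<integral>\<^sup>+s'. policy_value S A Q c \<gamma> (shift_policy (s, a) \<pi>) s' \<partial>Q (s, a)) \<partial>\<pi> 0 (\<lambda>_. undefined, s))"
proof -
  let ?u = "(\<lambda>_. undefined) :: nat \<Rightarrow> 's \<times> 'a"
  let ?D = "\<lambda>\<pi> s t. path_integral \<pi> s (Suc t) (\<lambda>\<omega>. c (\<omega> t))"
  note cm = measurable_cost[OF c]
  have u: "?u \<in> space (hist 0)" by (simp add: space_PiM)
  have "\<pi> 0 (?u, s) \<in> space (prob_algebra A)"
    by (rule measurable_space[OF measurable_policy[OF \<pi>]]) (simp add: space_pair_measure u s)
  then have "sets (\<pi> 0 (?u, s)) = sets (count_space UNIV)"
    by (simp add: space_prob_algebra A)
  from measurable_cong_sets[OF this refl, of "borel :: ennreal measure"]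
  have am: "f \<in> borel_measurable (\<pi> 0 (?u, s))" for f :: "'a \<Rightarrow> ennreal"
    by simp
  have inner: "(\<Sum>t. ennreal (\<gamma> ^ Suc t) * (\<integral>\<^sup>+s'. ?D (shift_policy (s, a) \<pi>) s' t \<partial>Q (s, a)))
     = ennreal \<gamma> * (\<integral>\<^sup>+s'. policy_value S A Q c \<gamma> (shift_policy (s, a) \<pi>) s' \<partial>Q (s, a))" for a
  proof -
    have q: "(s, a) \<in> space (S \<Otimes>\<^sub>M A)" using s by (simp add: space_pair_measure)
    note \<pi>' = shift_policy_in_policies[OF \<pi> q]
    have "Q (s, a) \<in> space (prob_algebra S)" by (rule measurable_space[OF Q q])
    then have [measurable_cong]: "sets (Q (s, a)) = sets S" and sp: "space (Q (s, a)) = space S"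
      by (auto simp: space_prob_algebra dest: sets_eq_imp_space_eq)
    note [measurable] = measurable_path_integral[OF \<pi>' cm]
    have "(\<integral>\<^sup>+s'. policy_value S A Q c \<gamma> (shift_policy (s, a) \<pi>) s' \<partial>Q (s, a))
      = (\<integral>\<^sup>+s'. (\<Sum>t. ennreal (\<gamma> ^ t) * ?D (shift_policy (s, a) \<pi>) s' t) \<partial>Q (s, a))"
      by (intro nn_integral_cong policy_value_eq_suminf[OF \<pi>' _ c]) (simp add: sp)
    also have "\<dots> = (\<Sum>t. \<integral>\<^sup>+s'. ennreal (\<gamma> ^ t) * ?D (shift_policy (s, a) \<pi>) s' t \<partial>Q (s, a))"
      by (rule nn_integral_suminf) measurable
    also have "\<dots> = (\<Sum>t. ennreal (\<gamma> ^ t) * (\<integral>\<^sup>+s'. ?D (shift_policy (s, a) \<pi>) s' t \<partial>Q (s, a)))"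
      by (intro suminf_cong nn_integral_cmult) measurable
    finally show ?thesis
      using \<gamma> by (simp add: ennreal_mult mult.assoc del: path_integral.simps)
  qed
  have D0: "?D \<pi> s 0 = (\<integral>\<^sup>+a. c (s, a) \<partial>\<pi> 0 (?u, s))"
    by (subst path_integral_1[OF \<pi> s cm]) simp
  have DSuc: "?D \<pi> s (Suc t) = (\<integral>\<^sup>+a. \<integral>\<^sup>+s'. ?D (shift_policy (s, a) \<pi>) s' t \<partial>Q (s, a) \<partial>\<pi> 0 (?u, s))" for t
    by (subst path_integral_shift[OF \<pi> s cm]) simp
  have "policy_value S A Q c \<gamma> \<pi> s = (\<Sum>t. ennreal (\<gamma> ^ t) * ?D \<pi> s t)"
    by (rule policy_value_eq_suminf[OF \<pi> s c])
  also have "\<dots> = ?D \<pi> s 0 + (\<Sum>t. ennreal (\<gamma> ^ Suc t) * ?D \<pi> s (Suc t))"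
    by (subst suminf_offset[of _ 1]) (simp_all del: path_integral.simps)
  also have "(\<Sum>t. ennreal (\<gamma> ^ Suc t) * ?D \<pi> s (Suc t)) = (\<integral>\<^sup>+a. (\<Sum>t. ennreal (\<gamma> ^ Suc t) *
      (\<integral>\<^sup>+s'. ?D (shift_policy (s, a) \<pi>) s' t \<partial>Q (s, a))) \<partial>\<pi> 0 (?u, s))"
    unfolding DSuc by (simp only: nn_integral_suminf[OF am] nn_integral_cmult[OF am])
  also have "?D \<pi> s 0 + \<dots> = (\<integral>\<^sup>+a. c (s, a) + ennreal \<gamma> *
      (\<integral>\<^sup>+s'. policy_value S A Q c \<gamma> (shift_policy (s, a) \<pi>) s' \<partial>Q (s, a)) \<partial>\<pi> 0 (?u, s))"
    unfolding D0 inner by (simp only: nn_integral_add[OF am am])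
  finally show ?thesis .
qed

lemma measurable_policy_value:
  assumes \<pi>: "\<pi> \<in> policies S A" and c[measurable]: "c \<in> borel_measurable (S \<Otimes>\<^sub>M A)"
  shows "policy_value S A Q c \<gamma> \<pi> \<in> borel_measurable S"
proof -
  note cm = measurable_cost[OF c]
  note [measurable] = measurable_path_integral[OF \<pi> cm]
  have "(\<lambda>s. \<Sum>t. ennreal (\<gamma> ^ t) * path_integral \<pi> s (Suc t) (\<lambda>\<omega>. c (\<omega> t))) \<in> borel_measurable S"
    by measurable
  also have "?this \<longleftrightarrow> ?thesis"
    by (intro measurable_cong) (simp only: policy_value_eq_suminf[OF \<pi> _ c])
  finally show ?thesis .
qed

end


section \<open>The restart problem\<close>

lemma suminf_le_of_step:
  fixes v d :: "nat \<Rightarrow> ennreal" and \<gamma> :: real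
  assumes \<gamma>: "0 \<le> \<gamma>" and step: "\<And>k. d k + ennreal \<gamma> * v (Suc k) \<le> v k"
  shows "(\<Sum>t. ennreal (\<gamma> ^ t) * d (k + t)) \<le> v k"
proof -
  have "(\<Sum>t<N. ennreal (\<gamma> ^ t) * d (k + t)) \<le> v k" for N
  proof (induction N arbitrary: k)
    case 0
    then show ?case by simp
  next
    case (Suc N)
    have "(\<Sum>t<Suc N. ennreal (\<gamma> ^ t) * d (k + t))
      = d k + ennreal \<gamma> * (\<Sum>t<N. ennreal (\<gamma> ^ t) * d (Suc k + t))"
      using \<gamma> by (simp add: sum.lessThan_Suc_shift ennreal_mult sum_distrib_left mult.assoc del: sum.lessThan_Suc)
    also have "\<dots> \<le> d k + ennreal \<gamma> * v (Suc k)"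
      by (intro add_left_mono mult_left_mono Suc.IH) simp
    also have "\<dots> \<le> v k" by (rule step)
    finally show ?case .
  qed
  then show ?thesis
    by (intro suminf_le_const summableI)
qed

lemma suminf_ennreal_geometric:
  assumes "0 \<le> \<gamma>" "\<gamma> < 1"
  shows "(\<Sum>t. ennreal (\<gamma> ^ t)) = ennreal (1 / (1 - \<gamma>))"
  using assms by (intro suminf_ennreal_eq geometric_sums) auto

locale restart_problem =
  fixes M :: "'x measure" and P :: "'x \<Rightarrow> 'x measure" and \<nu> :: "'x measure"
    and F :: "'x \<Rightarrow> ennreal" and G :: "action \<Rightarrow> real" and \<gamma> :: real
  assumes P[measurable]: "P \<in> M \<rightarrow>\<^sub>M prob_algebra M"
    and \<nu>: "\<nu> \<in> space (prob_algebra M)"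
    and F[measurable]: "F \<in> borel_measurable M"
    and \<gamma>: "0 < \<gamma>" "\<gamma> < 1"
begin

abbreviation S where "S \<equiv> restart_state_space M"
abbreviation c where "c \<equiv> restart_cost M P F G"
abbreviation V where "V \<equiv> restart_value M P \<nu> F G \<gamma>"
abbreviation f where "f k \<equiv> kernel_apply (kernel_power M P k) F"

sublocale discrete_action_mdp S action_space "restart_kernel M \<nu>"
  by standard (simp_all add: measurable_restart_kernel[OF \<nu>])

lemma measurable_kernel_power[measurable]: "kernel_power M P k \<in> M \<rightarrow>\<^sub>M prob_algebra M"
proof (induction k)
  case 0
  show ?case by (simp add: kernel_power.simps(1)[abs_def])
next
  case (Suc k)
  then show ?case
    by (simp add: kernel_power.simps(2)[abs_def] measurable_bind_prob_space[OF _ P])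
qed

lemma measurable_f[measurable]: "f k \<in> borel_measurable M"
  unfolding kernel_apply_def
  by (rule measurable_compose[OF measurable_prob_algebraD[OF measurable_kernel_power]
        nn_integral_measurable_subprob_algebra]) measurable

lemma restart_cost_eq: "c p = f (snd (fst p)) (fst (fst p)) + ennreal (G (snd p))"
  by (cases p) auto

lemma measurable_restart_cost[measurable]: "c \<in> borel_measurable (S \<Otimes>\<^sub>M action_space)"
proof -
  have "(\<lambda>p. f (snd (fst p)) (fst (fst p))) \<in> borel_measurable (S \<Otimes>\<^sub>M action_space)"
    unfolding restart_state_space_def
    by (rule measurable_compose_countable[where f = "\<lambda>k p. f k (fst (fst p))"]) measurable
  moreover have [measurable]: "G \<in> borel_measurable action_space"
    by simp
  ultimately show ?thesis
    unfolding restart_cost_eq[abs_def] restart_state_space_def by measurable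
qed

lemma space_S: "(x, k) \<in> space S \<longleftrightarrow> x \<in> space M"
  by (simp add: restart_state_space_def space_pair_measure)

lemma nn_integral_pair_return:
  assumes N: "N \<in> space (prob_algebra M)" and h: "h \<in> borel_measurable S"
  shows "(\<integral>\<^sup>+s. h s \<partial>(N \<Otimes>\<^sub>M return (count_space UNIV) k)) = (\<integral>\<^sup>+z. h (z, k) \<partial>N)"
proof -
  interpret prob_space "return (count_space UNIV) k" by (rule prob_space_return) simp
  have sets: "sets (N \<Otimes>\<^sub>M return (count_space UNIV) k) = sets S"
    using N unfolding restart_state_space_def by (intro sets_pair_measure_cong) (auto simp: space_prob_algebra)
  have "(\<integral>\<^sup>+s. h s \<partial>(N \<Otimes>\<^sub>M return (count_space UNIV) k))
    = (\<integral>\<^sup>+z. \<integral>\<^sup>+j. h (z, j) \<partial>return (count_space UNIV) k \<partial>N)"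
    using h by (intro nn_integral_fst[symmetric]) (simp add: measurable_cong_sets[OF sets refl])
  then show ?thesis by (simp add: nn_integral_return)
qed

lemma nn_integral_restart_kernel_n:
  assumes x: "x \<in> space M" and h: "h \<in> borel_measurable S"
  shows "(\<integral>\<^sup>+s. h s \<partial>restart_kernel M \<nu> ((x, k), No_Intervention)) = h (x, Suc k)"
proof -
  have "return M x \<in> space (prob_algebra M)"
    using x by (simp add: space_prob_algebra prob_space_return)
  moreover have "(\<lambda>z. h (z, Suc k)) \<in> borel_measurable M"
    by (rule measurable_compose[OF _ h]) (simp add: restart_state_space_def)
  ultimately show ?thesis
    using x by (simp add: nn_integral_pair_return[OF _ h] nn_integral_return)
qed

lemma nn_integral_restart_kernel_r:
  assumes h: "h \<in> borel_measurable S"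
  shows "(\<integral>\<^sup>+s. h s \<partial>restart_kernel M \<nu> ((x, k), Restart)) = (\<integral>\<^sup>+z. h (z, 0) \<partial>\<nu>)"
  by (simp add: nn_integral_pair_return[OF \<nu> h])

lemma restart_value_le:
  "\<pi> \<in> policies S action_space \<Longrightarrow> V s \<le> policy_value S action_space (restart_kernel M \<nu>) c \<gamma> \<pi> s"
  unfolding restart_value_def optimal_value_def by (rule INF_lower)

text \<open>
  Only this half of the optimality equation is needed. It does not require \<open>V\<close> to be measurable,
  as \<open>\<integral>\<^sup>+\<close> of a non-measurable function is a lower integral and is still monotone.
\<close>

lemma restart_value_ge:
  assumes x: "x \<in> space M"
  shows "f k x + min (ennreal (G No_Intervention) + ennreal \<gamma> * V (x, Suc k)) (restart_level M P \<nu> F G \<gamma>)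
    \<le> V (x, k)" (is "?B \<le> _")
proof -
  let ?v = "\<lambda>\<pi>. policy_value S action_space (restart_kernel M \<nu>) c \<gamma> \<pi>"
  have "?B \<le> (INF \<pi>\<in>policies S action_space. ?v \<pi> (x, k))"
  proof (rule INF_greatest)
  fix \<pi> assume \<pi>: "\<pi> \<in> policies S action_space"
  let ?s = "(x, k)" and ?u = "(\<lambda>_. undefined) :: nat \<Rightarrow> ('x \<times> nat) \<times> action"
  have s: "?s \<in> space S" using x by (simp add: space_S)
  have "\<pi> 0 (?u, ?s) \<in> space (prob_algebra action_space)"
    by (rule measurable_space[OF measurable_policy[OF \<pi>]]) (simp add: space_pair_measure space_PiM s)
  then interpret prob_space "\<pi> 0 (?u, ?s)" by (simp add: space_prob_algebra)
  have step: "?B \<le> c (?s, a) + ennreal \<gamma> * (\<integral>\<^sup>+s'. ?v (shift_policy (?s, a) \<pi>) s' \<partial>restart_kernel M \<nu> (?s, a))" for a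
  proof -
    have "shift_policy (?s, a) \<pi> \<in> policies S action_space"
      by (rule shift_policy_in_policies[OF \<pi>]) (simp add: space_pair_measure s)
    note V_le = restart_value_le[OF this] and vm = measurable_policy_value[OF this measurable_restart_cost]
    show ?thesis
    proof (cases a)
      case No_Intervention
      have "?B \<le> f k x + (ennreal (G a) + ennreal \<gamma> * V (x, Suc k))"
        using No_Intervention by (intro add_left_mono) simp
      also have "\<dots> \<le> f k x + (ennreal (G a) + ennreal \<gamma> * ?v (shift_policy (?s, a) \<pi>) (x, Suc k))"
        by (intro add_left_mono mult_left_mono V_le) simp
      finally show ?thesis
        using No_Intervention nn_integral_restart_kernel_n[OF x vm, of k] by (simp add: add.assoc)
    next
      case Restart
      have "?B \<le> f k x + (ennreal (G a) + ennreal \<gamma> * (\<integral>\<^sup>+z. V (z, 0) \<partial>\<nu>))"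
        using Restart by (intro add_left_mono) (simp add: restart_level_def)
      also have "\<dots> \<le> f k x + (ennreal (G a) + ennreal \<gamma> * (\<integral>\<^sup>+z. ?v (shift_policy (?s, a) \<pi>) (z, 0) \<partial>\<nu>))"
        by (intro add_left_mono mult_left_mono nn_integral_mono V_le) simp
      finally show ?thesis
        using Restart nn_integral_restart_kernel_r[OF vm, of x k] by (simp add: add.assoc)
    qed
  qed
  have "(\<integral>\<^sup>+a. ?B \<partial>\<pi> 0 (?u, ?s)) \<le> ?v \<pi> ?s"
    unfolding policy_value_first_step[OF \<pi> s measurable_restart_cost less_imp_le[OF \<gamma>(1)]]
    by (intro nn_integral_mono step)
  then show "?B \<le> ?v \<pi> (x, k)"
    by (simp add: emeasure_space_1)
  qed
  then show ?thesis
    by (simp only: restart_value_def[of M P \<nu> F G \<gamma>] optimal_value_def)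
qed

lemma always_n_in_policies: "always_n \<in> policies S action_space"
  unfolding always_n_def by (rule stationary_policy_in_policies) (simp add: split_beta')

lemma always_n_apply: "always_n t h = return action_space No_Intervention"
  by (simp add: always_n_def stationary_policy_def split_beta')

lemma shift_always_n: "shift_policy p always_n = always_n"
  by (simp add: fun_eq_iff shift_policy_def always_n_apply)

lemma path_integral_always_n:
  assumes x: "x \<in> space M"
  shows "path_integral always_n (x, k) (Suc t) (\<lambda>\<omega>. c (\<omega> t)) = c ((x, k + t), No_Intervention)"
proof (induction t arbitrary: k)
  case 0
  have cm: "(\<lambda>\<omega>. c (\<omega> 0)) \<in> borel_measurable (hist (Suc 0))"
    by (rule measurable_cost[OF measurable_restart_cost])
  show ?case
    using x by (subst path_integral_1[OF always_n_in_policies _ cm])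
      (simp_all add: space_S always_n_apply nn_integral_return)
next
  case (Suc t)
  note cm = measurable_cost[OF measurable_restart_cost]
  have "path_integral always_n (x, k) (Suc (Suc t)) (\<lambda>\<omega>. c (\<omega> (Suc t)))
    = (\<integral>\<^sup>+s'. path_integral always_n s' (Suc t) (\<lambda>\<omega>. c (\<omega> t))
        \<partial>restart_kernel M \<nu> ((x, k), No_Intervention))"
    using x by (subst path_integral_shift[OF always_n_in_policies _ cm])
      (simp_all add: space_S always_n_apply nn_integral_return shift_always_n del: restart_kernel.simps path_integral.simps)
  also have "\<dots> = path_integral always_n (x, Suc k) (Suc t) (\<lambda>\<omega>. c (\<omega> t))"
    by (rule nn_integral_restart_kernel_n[OF x measurable_path_integral[OF always_n_in_policies cm]])
  also have "\<dots> = c ((x, k + Suc t), No_Intervention)"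
    by (simp only: Suc.IH add_Suc add_Suc_right)
  finally show ?case .
qed

lemma always_n_value:
  assumes x: "x \<in> space M"
  shows "restart_policy_value M P \<nu> F G \<gamma> always_n (x, k)
    = (\<Sum>t. ennreal (\<gamma> ^ t) * (f (k + t) x + ennreal (G No_Intervention)))"
  unfolding restart_policy_value_def
  using x by (subst policy_value_eq_suminf[OF always_n_in_policies _ measurable_restart_cost])
    (simp_all add: space_S path_integral_always_n del: path_integral.simps)

lemma kernel_power_apply_mono:
  assumes ge: "\<And>x. x \<in> space M \<Longrightarrow> F x \<le> kernel_apply P F x" and x: "x \<in> space M"
  shows "incseq (\<lambda>k. f k x)"
proof (rule incseq_SucI)
  fix k
  have K: "kernel_power M P k x \<in> space (prob_algebra M)"
    by (rule measurable_space[OF measurable_kernel_power x])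
  then have sets: "sets (kernel_power M P k x) = sets M" by (simp add: space_prob_algebra)
  have "f k x \<le> (\<integral>\<^sup>+y. kernel_apply P F y \<partial>kernel_power M P k x)"
    unfolding kernel_apply_def[of "kernel_power M P k"]
    by (intro nn_integral_mono ge) (simp add: sets_eq_imp_space_eq[OF sets])
  also have "\<dots> = f (Suc k) x"
    using measurable_prob_algebraD[OF P]
    by (simp add: kernel_apply_def nn_integral_bind[OF F] measurable_cong_sets[OF sets refl])
  finally show "f k x \<le> f (Suc k) x" .
qed

lemma threshold_index_infinite:
  assumes "threshold_index M P \<nu> F G \<gamma> x = \<infinity>"
  shows "ennreal (G No_Intervention) + ennreal \<gamma> * V (x, Suc k) < restart_level M P \<nu> F G \<gamma>"
proof (rule ccontr)
  assume "\<not> ?thesis"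
  then have "threshold_index M P \<nu> F G \<gamma> x \<le> enat k"
    unfolding threshold_index_def by (intro Inf_lower) (auto simp: not_less)
  with assms show False by simp
qed

lemma always_n_value_le_of_prefer_n:
  assumes x: "x \<in> space M"
    and n: "\<And>k. ennreal (G No_Intervention) + ennreal \<gamma> * V (x, Suc k) \<le> restart_level M P \<nu> F G \<gamma>"
  shows "restart_policy_value M P \<nu> F G \<gamma> always_n (x, k) \<le> V (x, k)"
proof -
  have "(\<Sum>t. ennreal (\<gamma> ^ t) * (f (k + t) x + ennreal (G No_Intervention))) \<le> V (x, k)"
  proof (rule suminf_le_of_step)
    show "f k x + ennreal (G No_Intervention) + ennreal \<gamma> * V (x, Suc k) \<le> V (x, k)" for k
      using restart_value_ge[OF x, of k] n[of k] by (simp add: min_absorb1 add.assoc)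
  qed (use \<gamma> in simp)
  then show ?thesis
    by (simp add: always_n_value[OF x])
qed

end

theorem lemma3:
  fixes X :: "'x::polish_space set"
    and M :: "'x measure"
    and P :: "'x \<Rightarrow> 'x measure"
    and \<nu> :: "'x measure"
    and F :: "'x \<Rightarrow> ennreal"
    and G :: "action \<Rightarrow> real"
    and L C \<rho> \<gamma> :: real
  assumes X: "X \<in> sets borel"
    and M: "M = restrict_space borel X"
    and P: "P \<in> M \<rightarrow>\<^sub>M prob_algebra M"
    and \<nu>: "\<nu> \<in> space (prob_algebra M)"
    and F: "F \<in> borel_measurable M"
    and G: "\<And>a. 0 \<le> G a"
    and PF_ge: "\<And>x. x \<in> X \<Longrightarrow> F x \<le> kernel_apply P F x"
    and \<rho>: "0 < \<rho>" "\<rho> < 1"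
    and ergodic: "\<And>t. (SUP x\<in>X. \<bar>enn2ereal (kernel_apply (kernel_power M P t) F x) - ereal L\<bar>)
                    \<le> ereal (C * \<rho> ^ t)"
    and \<gamma>: "0 < \<gamma>" "\<gamma> < 1"
    and never: "\<exists>x\<in>X. threshold_index M P \<nu> F G \<gamma> x = \<infinity>"
  shows "\<forall>y\<in>X. \<forall>k. restart_policy_value M P \<nu> F G \<gamma> always_n (y, k)
                     = restart_value M P \<nu> F G \<gamma> (y, k)"
proof -
  interpret restart_problem M P \<nu> F G \<gamma>
    by standard (fact P \<nu> F \<gamma>)+
  have spM: "space M = X" by (simp add: M space_restrict_space)
  let ?g = "G No_Intervention" and ?A = "restart_level M P \<nu> F G \<gamma>"
  let ?U = "restart_policy_value M P \<nu> F G \<gamma> always_n"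
  have mono: "incseq (\<lambda>k. f k x)" if "x \<in> X" for x
    using that by (intro kernel_power_apply_mono) (simp_all add: spM PF_ge)
  have lim: "(\<lambda>k. f k x) \<longlonglongrightarrow> ennreal L" if x: "x \<in> X" for x
  proof -
    have bound: "\<bar>enn2ereal (f k x) - ereal L\<bar> \<le> ereal (C * \<rho> ^ k)" for k
      using ergodic[of k] x by (auto simp: SUP_le_iff)
    have fin: "f k x = ennreal (enn2real (f k x))" for k
      using bound[of k] by (cases "f k x") auto
    have dist: "\<bar>enn2real (f k x) - L\<bar> \<le> C * \<rho> ^ k" for k
      using bound[of k] by (subst (asm) fin) (simp add: enn2ereal_ennreal)
    have "(\<lambda>k. C * \<rho> ^ k) \<longlonglongrightarrow> 0"
      using \<rho> by (auto intro!: tendsto_mult_right_zero LIMSEQ_realpow_zero)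
    then have "(\<lambda>k. enn2real (f k x) - L) \<longlonglongrightarrow> 0"
      by (rule Lim_null_comparison[rotated]) (simp add: dist)
    then have "(\<lambda>k. enn2real (f k x)) \<longlonglongrightarrow> L"
      by (simp add: LIM_zero_iff)
    then show ?thesis
      by (subst fin) (rule tendsto_ennrealI)
  qed
  have f_le: "f k x \<le> ennreal L" if "x \<in> X" for k x
    by (rule incseq_le[OF mono[OF that] lim[OF that]])
  have sum_const: "(\<Sum>t. ennreal (\<gamma> ^ t) * b) = ennreal (1 / (1 - \<gamma>)) * b" for b
    by (simp only: ennreal_suminf_multc suminf_ennreal_geometric[OF less_imp_le[OF \<gamma>(1)] \<gamma>(2)])
  let ?W = "ennreal (1 / (1 - \<gamma>)) * (ennreal L + ennreal ?g)"
  have U_le: "?U (x, k) \<le> ?W" if x: "x \<in> X" for x k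
  proof -
    have "ennreal (\<gamma> ^ t) * (f (k + t) x + ennreal ?g) \<le> ennreal (\<gamma> ^ t) * (ennreal L + ennreal ?g)" for t
      using f_le[OF x] by (intro mult_left_mono add_right_mono) simp_all
    then have "?U (x, k) \<le> (\<Sum>t. ennreal (\<gamma> ^ t) * (ennreal L + ennreal ?g))"
      unfolding always_n_value[OF x[folded spM]] by (rule suminf_le[OF _ summableI summableI])
    then show ?thesis by (simp only: sum_const)
  qed
  have U_ge: "ennreal (1 / (1 - \<gamma>)) * (f k x + ennreal ?g) \<le> ?U (x, k)" if x: "x \<in> X" for x k
  proof -
    have "ennreal (\<gamma> ^ t) * (f k x + ennreal ?g) \<le> ennreal (\<gamma> ^ t) * (f (k + t) x + ennreal ?g)" for t
      using incseqD[OF mono[OF x], of k "k + t"] by (intro mult_left_mono add_right_mono) simp_all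
    then have "(\<Sum>t. ennreal (\<gamma> ^ t) * (f k x + ennreal ?g)) \<le> ?U (x, k)"
      unfolding always_n_value[OF x[folded spM]] by (rule suminf_le[OF _ summableI summableI])
    then show ?thesis by (simp only: sum_const)
  qed
  have V_le: "V s \<le> ?U s" for s
    unfolding restart_policy_value_def by (rule restart_value_le[OF always_n_in_policies])
  obtain x where x: "x \<in> X" and inf: "threshold_index M P \<nu> F G \<gamma> x = \<infinity>"
    using never by auto
  have "ennreal ?g + ennreal \<gamma> * ?W \<le> ?A"
  proof (rule LIMSEQ_le_const2)
    show "(\<lambda>k. ennreal ?g + ennreal \<gamma> * (ennreal (1 / (1 - \<gamma>)) * (f (Suc k) x + ennreal ?g)))
        \<longlonglongrightarrow> ennreal ?g + ennreal \<gamma> * ?W"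
      by (intro tendsto_add tendsto_const tendsto_mult_ennreal LIMSEQ_Suc lim[OF x]) (use \<gamma> in auto)
    show "\<exists>N. \<forall>k\<ge>N. ennreal ?g + ennreal \<gamma> * (ennreal (1 / (1 - \<gamma>)) * (f (Suc k) x + ennreal ?g)) \<le> ?A"
    proof (intro exI allI impI)
      fix k
      have "?U (x, Suc k) \<le> V (x, Suc k)"
        using x threshold_index_infinite[OF inf]
        by (intro always_n_value_le_of_prefer_n) (auto simp: spM intro: less_imp_le)
      then have "ennreal (1 / (1 - \<gamma>)) * (f (Suc k) x + ennreal ?g) \<le> V (x, Suc k)"
        using U_ge[OF x] by (rule order_trans[rotated])
      then have "ennreal ?g + ennreal \<gamma> * (ennreal (1 / (1 - \<gamma>)) * (f (Suc k) x + ennreal ?g))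
          \<le> ennreal ?g + ennreal \<gamma> * V (x, Suc k)"
        by (intro add_left_mono mult_left_mono) simp_all
      also have "\<dots> \<le> ?A"
        using threshold_index_infinite[OF inf] by (rule less_imp_le)
      finally show "ennreal ?g + ennreal \<gamma> * (ennreal (1 / (1 - \<gamma>)) * (f (Suc k) x + ennreal ?g)) \<le> ?A" .
    qed
  qed
  then have n_better: "ennreal ?g + ennreal \<gamma> * V (y, Suc k) \<le> ?A" if "y \<in> X" for y k
    using order_trans[OF V_le U_le[OF that]]
    by (elim order_trans[rotated]) (intro add_left_mono mult_left_mono, simp_all)
  have "?U (y, k) = V (y, k)" if y: "y \<in> X" for y k
    by (intro antisym V_le always_n_value_le_of_prefer_n n_better) (simp_all add: spM y)
  then show ?thesis by blast
qed

end
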